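(* Let $\mathcal{H}_2[u,\bar u]=D(u)u_{xx}+R(u,\bar u)$. In each of the following cases (all parameters $a_i,b_i,c_i,\delta$ real, with $a_0>0$ in (5) and $a_1>0$ in (6)), the linear space $\mathcal{W}$ of functions of $x$ is invariant under $\mathcal{H}_2$: (1) $\mathcal{W}=\mathrm{Span}\{e^{-a_0x}\}$, $D(u)=\sum_{i=0}^{n}b_iu^i$, $R(u,\bar u)=\sum_{i=1}^{n+1}c_iu^i+\delta\bar u$, $n\in\mathbb{N}$, provided $c_{k+1}=-a_0^2b_k$ for $k=1,\dots,n$. (2) $\mathcal{W}=\mathrm{Span}\{1,e^{-a_1x}\}$, $D(u)=b_1u+b_0$, $R(u,\bar u)=-a_1^2b_1u^2+c_1u+\delta\bar u+c_0$. (3) $\mathcal{W}=\mathrm{Span}\{1,x\}$, $D(u)$ an arbitrary function (in particular any polynomial in $u$ of degree at most $1$, $2$ or $3$), $R(u,\bar u)=c_1u+\delta\bar u+c_0$. (4) $\mathcal{W}=\mathrm{Span}\{1,x,x^2\}$, $D(u)=b_1u+b_0$, $R(u,\bar u)=c_1u+\delta\bar u+c_0$. (5) $\mathcal{W}=\mathrm{Span}\{\cos(\sqrt{a_0}\,x),\sin(\sqrt{a_0}\,x)\}$, and either $D(u)=b_2u^2+b_1u+b_0$ with $R(u,\bar u)=a_0b_2u^3+a_0b_1u^2+c_1u+\delta\bar u$, or $D(u)=b_1u+b_0$ with $R(u,\bar u)=a_0b_1u^2+c_1u+\delta\bar u$. (6) $\mathcal{W}=\mathrm{Span}\{1,\cos(\sqrt{a_1}\,x),\sin(\sqrt{a_1}\,x)\}$,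 $D(u)=b_1u+b_0$, $R(u,\bar u)=a_1b_1u^2+c_1u+\delta\bar u+c_0$.
   Context: $\mathcal{H}_2$ is the right-hand side of the delayed heat equation with source $\frac{\partial^\alpha u}{\partial t^\alpha}=D(u)u_{xx}+R(u,\bar u)$, with $\bar u=u(x,t-\tau)$. In the claim $u$ and $\bar u$ are regarded as two independent elements of $\mathcal{W}$; subscript $x$ denotes differentiation in $x$. The space $\mathcal{W}$ is invariant under $\mathcal{H}_2$ if $\mathcal{H}_2[u,\bar u]\in\mathcal{W}$ for all $u,\bar u\in\mathcal{W}$. *)

theory Defs
  imports "HOL-Analysis.Analysis" "HOL-Library.Function_Algebras"
begin

text \<open>
  Functions of the space variable form a real vector space with pointwise operations, so that
  the library's \<^const>\<open>span\<close> applies to sets of functions.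
\<close>

instantiation "fun" :: (type, real_vector) real_vector
begin

definition scaleR_fun :: "real \<Rightarrow> ('a \<Rightarrow> 'b) \<Rightarrow> 'a \<Rightarrow> 'b"
  where "scaleR_fun r f = (\<lambda>x. r *\<^sub>R f x)"

instance
  by standard (auto simp: scaleR_fun_def fun_eq_iff scaleR_add_right scaleR_add_left)

end

definition H2 :: "(real \<Rightarrow> real) \<Rightarrow> (real \<Rightarrow> real \<Rightarrow> real) \<Rightarrow>
    (real \<Rightarrow> real) \<Rightarrow> (real \<Rightarrow> real) \<Rightarrow> (real \<Rightarrow> real)"
  where "H2 D R u ubar = (\<lambda>x. D (u x) * deriv (deriv u) x + R (u x) (ubar x))"

text \<open>
  The state and its delayed value range over the space independently of each other.
\<close>

definition invariant_under ::
    "(real \<Rightarrow> real) set \<Rightarrow> ((real \<Rightarrow> real) \<Rightarrow> (real \<Rightarrow> real) \<Rightarrow> (real \<Rightarrow> real)) \<Rightarrow> bool"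
  where "invariant_under W H \<longleftrightarrow> (\<forall>u\<in>W. \<forall>ubar\<in>W. H u ubar \<in> W)"

end

(*
  In the exponential and trigonometric cases every u in W satisfies u'' = k (u - p) for a
  constant p that depends on u (p = 0 when W contains no constants), and the leading
  coefficients of R are exactly those for which k u D(u) + R(u, ubar) is affine; in the
  polynomial cases u'' is itself constant. Either way H2[u, ubar] = r + s u + \<delta> ubar with
  constants r, s depending on u, and W contains the constant r.
*)
theory Submission
  imports Defs
begin

text \<open>Peels one generator off a span. Iterated down to \<open>span {}\<close>, which contains
  only zero, it turns membership in a finite span into explicit coordinates.\<close>

lemma in_span_insertE:
  fixes f u :: "real \<Rightarrow> real"
  assumes "u \<in> span (insert f S)"
  obtains p v where "v \<in> span S" "u = (\<lambda>x. p * f x + v x)"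
proof -
  from assms obtain p where "u - p *\<^sub>R f \<in> span S"
    by (auto simp: span_insert)
  moreover have "u = (\<lambda>x. p * f x + (u - p *\<^sub>R f) x)"
    by (simp add: scaleR_fun_def)
  ultimately show ?thesis by (rule that)
qed

lemma in_span1E:
  fixes f u :: "real \<Rightarrow> real"
  assumes "u \<in> span {f}"
  obtains p where "u = (\<lambda>x. p * f x)"
  using assms by (elim in_span_insertE) simp

lemma in_span2E:
  fixes f g u :: "real \<Rightarrow> real"
  assumes "u \<in> span {f, g}"
  obtains p q where "u = (\<lambda>x. p * f x + q * g x)"
  using assms by (elim in_span_insertE) simp

lemma in_span3E:
  fixes f g h u :: "real \<Rightarrow> real"
  assumes "u \<in> span {f, g, h}"
  obtains p q r where "u = (\<lambda>x. p * f x + q * g x + r * h x)"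
  using assms by (elim in_span_insertE) (simp add: add.assoc)

lemma zero_in_span_fun: "(\<lambda>x. 0) \<in> span (S :: (real \<Rightarrow> real) set)"
  using span_zero[of S] by (simp add: zero_fun_def)

lemma const_in_span:
  fixes S :: "(real \<Rightarrow> real) set"
  assumes "(\<lambda>x. 1) \<in> S"
  shows "(\<lambda>x. r) \<in> span S"
  using span_scale[OF span_base[OF assms], of r] by (simp add: scaleR_fun_def)

lemma deriv_deriv_eq:
  fixes u u' u'' :: "real \<Rightarrow> real"
  assumes "\<And>x. (u has_real_derivative u' x) (at x)"
    and "\<And>x. (u' has_real_derivative u'' x) (at x)"
  shows "deriv (deriv u) = u''"
proof -
  have "deriv u = u'" using assms(1) by (auto intro: DERIV_imp_deriv)
  then show ?thesis using assms(2) by (auto intro: DERIV_imp_deriv)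
qed

text \<open>Differentiation kills the constant \<open>p\<close>, so with u denoting the function on
  the left this reads u'' = a^2 (u - p). Taking \<open>p\<close> = 0 serves the span without
  constants.\<close>

lemma deriv_deriv_exp:
  "deriv (deriv (\<lambda>x::real. p + q * exp (- a * x))) = (\<lambda>x. a\<^sup>2 * (q * exp (- a * x)))"
  by (rule deriv_deriv_eq[where u' = "\<lambda>x. - a * (q * exp (- a * x))"])
    (auto intro!: derivative_eq_intros simp: power2_eq_square)

lemma deriv_deriv_quadratic:
  "deriv (deriv (\<lambda>x::real. p + q * x + r * x\<^sup>2)) = (\<lambda>x. 2 * r)"
  by (rule deriv_deriv_eq[where u' = "\<lambda>x. q + 2 * r * x"])
    (auto intro!: derivative_eq_intros)

lemma deriv_deriv_cos_sin:
  fixes a :: real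
  assumes "a \<ge> 0"
  shows "deriv (deriv (\<lambda>x. p + q * cos (sqrt a * x) + r * sin (sqrt a * x))) =
    (\<lambda>x. - a * (q * cos (sqrt a * x) + r * sin (sqrt a * x)))"
proof (rule deriv_deriv_eq)
  let ?u' = "\<lambda>x. sqrt a * (r * cos (sqrt a * x) - q * sin (sqrt a * x))"
  show "((\<lambda>x. p + q * cos (sqrt a * x) + r * sin (sqrt a * x)) has_real_derivative ?u' x) (at x)"
    for x by (auto intro!: derivative_eq_intros simp: algebra_simps)
  \<comment> \<open>Differentiating \<open>?u'\<close> brings out a second factor
    \<open>sqrt a\<close>; the sign condition on \<open>a\<close> makes the two collapse to
    \<open>a\<close>.\<close>
  have sq: "sqrt a * (sqrt a * y) = a * y" for y
    using assms by (simp flip: mult.assoc)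
  show "(?u' has_real_derivative - a * (q * cos (sqrt a * x) + r * sin (sqrt a * x))) (at x)"
    for x by (auto intro!: derivative_eq_intros simp: sq algebra_simps)
qed

text \<open>The hypothesis makes H2[u, ubar] a linear combination of a constant function,
  \<open>u\<close> and \<open>ubar\<close>, all in the span. The numbers \<open>r\<close> and
  \<open>s\<close> may depend on \<open>u\<close> but are chosen before \<open>x\<close> and
  \<open>w\<close>; the real \<open>w\<close> stands for the value of \<open>ubar\<close> at
  \<open>x\<close>.\<close>

lemma invariant_under_spanI:
  assumes "\<And>u. u \<in> span S \<Longrightarrow> \<exists>r s. (\<lambda>x. r) \<in> span S \<and>
    (\<forall>x w. D (u x) * deriv (deriv u) x + R (u x) w = r + s * u x + \<delta> * w)"
  shows "invariant_under (span S) (H2 D R)"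
  unfolding invariant_under_def
proof (intro ballI)
  fix u ubar assume u: "u \<in> span S" and ubar: "ubar \<in> span S"
  from assms[OF u] obtain r s where r: "(\<lambda>x. r) \<in> span S"
    and eq: "\<And>x w. D (u x) * deriv (deriv u) x + R (u x) w = r + s * u x + \<delta> * w"
    by blast
  have "H2 D R u ubar = (\<lambda>x. r) + s *\<^sub>R u + \<delta> *\<^sub>R ubar"
    by (auto simp: H2_def eq scaleR_fun_def)
  then show "H2 D R u ubar \<in> span S"
    using r u ubar by (simp add: span_add span_scale)
qed

lemma invariant_exp:
  assumes "\<forall>k\<in>{1..n}. c (k + 1) = - a0\<^sup>2 * b k"
  shows "invariant_under (span {\<lambda>x. exp (- a0 * x)})
    (H2 (\<lambda>v. \<Sum>i=0..n. b i * v ^ i) (\<lambda>v w. (\<Sum>i=1..n+1. c i * v ^ i) + \<delta> * w))"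
proof (rule invariant_under_spanI)
  fix u assume "u \<in> span {\<lambda>x. exp (- a0 * x)}"
  then obtain q where u: "u = (\<lambda>x. q * exp (- a0 * x))" by (rule in_span1E)
  have dd: "deriv (deriv u) = (\<lambda>x. a0\<^sup>2 * u x)"
    using deriv_deriv_exp[of 0 q a0] by (simp add: u)
  \<comment> \<open>Since u'' = a0^2 u, the sum is a polynomial in the value \<open>v\<close> of
    \<open>u\<close>, and all its terms above the linear one must cancel.\<close>
  have "(\<Sum>i=0..n. b i * v ^ i) * (a0\<^sup>2 * v) + (\<Sum>i=1..n+1. c i * v ^ i) =
      (a0\<^sup>2 * b 0 + c 1) * v" for v
  proof -
    \<comment> \<open>Shifting the index by one aligns the reaction term with the diffusion term:
      both now carry \<open>v ^ (i + 1)\<close> for \<open>i\<close> from 0 to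
      \<open>n\<close>.\<close>
    have "(\<Sum>i=1..n+1. c i * v ^ i) = (\<Sum>i=0..n. c (i + 1) * v ^ (i + 1))"
      using sum.shift_bounds_cl_nat_ivl[of "\<lambda>i. c i * v ^ i" 0 1 n] by simp
    then have "(\<Sum>i=0..n. b i * v ^ i) * (a0\<^sup>2 * v) + (\<Sum>i=1..n+1. c i * v ^ i) =
        (\<Sum>i=0..n. (a0\<^sup>2 * b i + c (i + 1)) * v ^ (i + 1))"
      by (simp add: sum_distrib_left sum.distrib algebra_simps)
    \<comment> \<open>The hypothesis on \<open>c\<close> annihilates the coefficients with 1 \<le> i
      \<le> n; index 0 lies outside its range and gives the linear term.\<close>
    also have "\<dots> = (\<Sum>i\<in>{0}. (a0\<^sup>2 * b i + c (i + 1)) * v ^ (i + 1))"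
      using assms by (intro sum.mono_neutral_right) auto
    finally show ?thesis by simp
  qed
  then show "\<exists>r s. (\<lambda>x. r) \<in> span {\<lambda>x. exp (- a0 * x)} \<and> (\<forall>x w.
      (\<Sum>i=0..n. b i * u x ^ i) * deriv (deriv u) x + ((\<Sum>i=1..n+1. c i * u x ^ i) + \<delta> * w) =
      r + s * u x + \<delta> * w)"
    by (intro exI[of _ 0] exI[of _ "a0\<^sup>2 * b 0 + c 1"])
      (simp add: dd zero_in_span_fun flip: add.assoc)
qed

lemma invariant_const_exp:
  "invariant_under (span {\<lambda>x. 1, \<lambda>x. exp (- a1 * x)})
    (H2 (\<lambda>v. b1 * v + b0) (\<lambda>v w. - a1\<^sup>2 * b1 * v\<^sup>2 + c1 * v + \<delta> * w + c0))"
proof (rule invariant_under_spanI)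
  let ?S = "{\<lambda>x. 1, \<lambda>x. exp (- a1 * x)}"
  fix u assume "u \<in> span ?S"
  then obtain p q where u: "u = (\<lambda>x. p * 1 + q * exp (- a1 * x))" by (rule in_span2E)
  have dd: "deriv (deriv u) = (\<lambda>x. a1\<^sup>2 * (u x - p))"
    using deriv_deriv_exp[of p q a1] by (simp add: u)
  show "\<exists>r s. (\<lambda>x. r) \<in> span ?S \<and> (\<forall>x w. (b1 * u x + b0) * deriv (deriv u) x +
      (- a1\<^sup>2 * b1 * (u x)\<^sup>2 + c1 * u x + \<delta> * w + c0) = r + s * u x + \<delta> * w)"
    \<comment> \<open>Expanding (b1 u + b0) a1^2 (u - p) gives a1^2 b1 u^2 + a1^2 (b0 - b1 p) u -
      a1^2 b0 p. The square cancels against the reaction term; the rest gives the two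
      witnesses.\<close>
    by (intro exI[of _ "c0 - a1\<^sup>2 * b0 * p"] exI[of _ "c1 + a1\<^sup>2 * (b0 - b1 * p)"])
      (auto simp: dd const_in_span algebra_simps power2_eq_square)
qed

text \<open>An affine \<open>u\<close> has u'' = 0, so the diffusion term vanishes whatever
  \<open>D\<close> is, and the reaction term is already affine.\<close>

lemma invariant_linear:
  "invariant_under (span {\<lambda>x. 1, \<lambda>x. x}) (H2 D (\<lambda>v w. c1 * v + \<delta> * w + c0))"
proof (rule invariant_under_spanI)
  let ?S = "{\<lambda>x. 1, \<lambda>x. x} :: (real \<Rightarrow> real) set"
  fix u assume "u \<in> span ?S"
  then obtain p q where u: "u = (\<lambda>x. p * 1 + q * x)" by (rule in_span2E)
  have dd: "deriv (deriv u) = (\<lambda>x. 0)"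
    using deriv_deriv_quadratic[of p q 0] by (simp add: u)
  show "\<exists>r s. (\<lambda>x. r) \<in> span ?S \<and> (\<forall>x w. D (u x) * deriv (deriv u) x +
      (c1 * u x + \<delta> * w + c0) = r + s * u x + \<delta> * w)"
    by (intro exI[of _ c0] exI[of _ c1]) (auto simp: dd const_in_span)
qed

text \<open>Here u'' is the constant 2k, with k the coefficient of x^2, so D(u) u'' is affine in
  \<open>u\<close> because \<open>D\<close> is.\<close>

lemma invariant_quadratic:
  "invariant_under (span {\<lambda>x. 1, \<lambda>x. x, \<lambda>x. x\<^sup>2})
    (H2 (\<lambda>v. b1 * v + b0) (\<lambda>v w. c1 * v + \<delta> * w + c0))"
proof (rule invariant_under_spanI)
  let ?S = "{\<lambda>x. 1, \<lambda>x. x, \<lambda>x. x\<^sup>2} :: (real \<Rightarrow> real) set"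
  fix u assume "u \<in> span ?S"
  then obtain p q k where u: "u = (\<lambda>x. p * 1 + q * x + k * x\<^sup>2)" by (rule in_span3E)
  have dd: "deriv (deriv u) = (\<lambda>x. 2 * k)"
    using deriv_deriv_quadratic[of p q k] by (simp add: u)
  show "\<exists>r s. (\<lambda>x. r) \<in> span ?S \<and> (\<forall>x w. (b1 * u x + b0) * deriv (deriv u) x +
      (c1 * u x + \<delta> * w + c0) = r + s * u x + \<delta> * w)"
    by (intro exI[of _ "c0 + 2 * k * b0"] exI[of _ "c1 + 2 * k * b1"])
      (auto simp: dd const_in_span algebra_simps)
qed

lemma invariant_cos_sin:
  fixes a0 :: real
  assumes "a0 \<ge> 0"
  shows "invariant_under (span {\<lambda>x. cos (sqrt a0 * x), \<lambda>x. sin (sqrt a0 * x)})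
    (H2 (\<lambda>v. b2 * v\<^sup>2 + b1 * v + b0)
      (\<lambda>v w. a0 * b2 * v ^ 3 + a0 * b1 * v\<^sup>2 + c1 * v + \<delta> * w))"
proof (rule invariant_under_spanI)
  let ?S = "{\<lambda>x. cos (sqrt a0 * x), \<lambda>x. sin (sqrt a0 * x)}"
  fix u assume "u \<in> span ?S"
  then obtain p q where u: "u = (\<lambda>x. p * cos (sqrt a0 * x) + q * sin (sqrt a0 * x))"
    by (rule in_span2E)
  have dd: "deriv (deriv u) = (\<lambda>x. - a0 * u x)"
    using deriv_deriv_cos_sin[OF assms, of 0 p q] by (simp add: u)
  show "\<exists>r s. (\<lambda>x. r) \<in> span ?S \<and> (\<forall>x w. (b2 * (u x)\<^sup>2 + b1 * u x + b0) * deriv (deriv u) x +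
      (a0 * b2 * u x ^ 3 + a0 * b1 * (u x)\<^sup>2 + c1 * u x + \<delta> * w) = r + s * u x + \<delta> * w)"
    \<comment> \<open>The diffusion term is -a0 u (b2 u^2 + b1 u + b0): its cubic and quadratic
      parts cancel against the reaction term, leaving -a0 b0 u and no constant.\<close>
    by (intro exI[of _ 0] exI[of _ "c1 - a0 * b0"])
      (auto simp: dd zero_in_span_fun algebra_simps power2_eq_square power3_eq_cube)
qed

text \<open>The constant part p of \<open>u\<close> shifts the equation to u'' = -a1 (u - p). A term
  b2 u^2 in the diffusivity would contribute a1 b2 p u^2, whose coefficient varies with
  \<open>u\<close> and cannot be cancelled by fixed reaction coefficients; hence the affine
  diffusivity.\<close>

lemma invariant_const_cos_sin:
  fixes a1 :: real
  assumes "a1 \<ge> 0"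
  shows "invariant_under (span {\<lambda>x. 1, \<lambda>x. cos (sqrt a1 * x), \<lambda>x. sin (sqrt a1 * x)})
    (H2 (\<lambda>v. b1 * v + b0) (\<lambda>v w. a1 * b1 * v\<^sup>2 + c1 * v + \<delta> * w + c0))"
proof (rule invariant_under_spanI)
  let ?S = "{\<lambda>x. 1, \<lambda>x. cos (sqrt a1 * x), \<lambda>x. sin (sqrt a1 * x)}"
  fix u assume "u \<in> span ?S"
  then obtain p q k where
    u: "u = (\<lambda>x. p * 1 + q * cos (sqrt a1 * x) + k * sin (sqrt a1 * x))"
    by (rule in_span3E)
  have dd: "deriv (deriv u) = (\<lambda>x. - a1 * (u x - p))"
    using deriv_deriv_cos_sin[OF assms, of p q k] by (simp add: u)
  show "\<exists>r s. (\<lambda>x. r) \<in> span ?S \<and> (\<forall>x w. (b1 * u x + b0) * deriv (deriv u) x +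
      (a1 * b1 * (u x)\<^sup>2 + c1 * u x + \<delta> * w + c0) = r + s * u x + \<delta> * w)"
    by (intro exI[of _ "c0 + a1 * b0 * p"] exI[of _ "c1 - a1 * (b0 - b1 * p)"])
      (auto simp: dd const_in_span algebra_simps power2_eq_square)
qed

theorem mainTheorem4:
  shows
    "(\<forall>(n::nat) (a0::real) (b::nat \<Rightarrow> real) (c::nat \<Rightarrow> real) (\<delta>::real).
        (\<forall>k\<in>{1..n}. c (k + 1) = - a0\<^sup>2 * b k) \<longrightarrow>
        invariant_under (span {\<lambda>x. exp (- a0 * x)})
          (H2 (\<lambda>v. \<Sum>i=0..n. b i * v ^ i)
              (\<lambda>v w. (\<Sum>i=1..n+1. c i * v ^ i) + \<delta> * w)))
   \<and> (\<forall>(a1::real) (b0::real) (b1::real) (c0::real) (c1::real) (\<delta>::real).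
        invariant_under (span {\<lambda>x. 1, \<lambda>x. exp (- a1 * x)})
          (H2 (\<lambda>v. b1 * v + b0)
              (\<lambda>v w. - a1\<^sup>2 * b1 * v\<^sup>2 + c1 * v + \<delta> * w + c0)))
   \<and> (\<forall>(D::real \<Rightarrow> real) (c0::real) (c1::real) (\<delta>::real).
        invariant_under (span {\<lambda>x. 1, \<lambda>x. x})
          (H2 D (\<lambda>v w. c1 * v + \<delta> * w + c0)))
   \<and> (\<forall>(b0::real) (b1::real) (c0::real) (c1::real) (\<delta>::real).
        invariant_under (span {\<lambda>x. 1, \<lambda>x. x, \<lambda>x. x\<^sup>2})
          (H2 (\<lambda>v. b1 * v + b0)
              (\<lambda>v w. c1 * v + \<delta> * w + c0)))
   \<and> (\<forall>(a0::real) (b0::real) (b1::real) (b2::real) (c1::real) (\<delta>::real). a0 > 0 \<longrightarrow>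
        invariant_under (span {\<lambda>x. cos (sqrt a0 * x), \<lambda>x. sin (sqrt a0 * x)})
          (H2 (\<lambda>v. b2 * v\<^sup>2 + b1 * v + b0)
              (\<lambda>v w. a0 * b2 * v ^ 3 + a0 * b1 * v\<^sup>2 + c1 * v + \<delta> * w))
      \<and> invariant_under (span {\<lambda>x. cos (sqrt a0 * x), \<lambda>x. sin (sqrt a0 * x)})
          (H2 (\<lambda>v. b1 * v + b0)
              (\<lambda>v w. a0 * b1 * v\<^sup>2 + c1 * v + \<delta> * w)))
   \<and> (\<forall>(a1::real) (b0::real) (b1::real) (c0::real) (c1::real) (\<delta>::real). a1 > 0 \<longrightarrow>
        invariant_under (span {\<lambda>x. 1, \<lambda>x. cos (sqrt a1 * x), \<lambda>x. sin (sqrt a1 * x)})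
          (H2 (\<lambda>v. b1 * v + b0)
              (\<lambda>v w. a1 * b1 * v\<^sup>2 + c1 * v + \<delta> * w + c0)))"
proof (intro conjI allI impI, goal_cases)
  case (1 n a0 b c \<delta>)
  then show ?case by (rule invariant_exp)
next
  case (2 a1 b0 b1 c0 c1 \<delta>)
  show ?case by (rule invariant_const_exp)
next
  case (3 D c0 c1 \<delta>)
  show ?case by (rule invariant_linear)
next
  case (4 b0 b1 c0 c1 \<delta>)
  show ?case by (rule invariant_quadratic)
next
  case (5 a0 b0 b1 b2 c1 \<delta>)
  then show ?case by (intro invariant_cos_sin) simp
next
  case (6 a0 b0 b1 b2 c1 \<delta>)
  \<comment> \<open>The affine diffusivity is the quadratic one with \<open>b2\<close> = 0, which
    also removes the cubic reaction term.\<close>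
  then show ?case using invariant_cos_sin[of a0 0 b1 b0 c1 \<delta>] by simp
next
  case (7 a1 b0 b1 c0 c1 \<delta>)
  then show ?case by (intro invariant_const_cos_sin) simp
qed

end
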